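(* Let $k\ge 2$ be an integer. If a finite graph $G$ has an acyclic coloring with at most $k$ colors, then $G$ has an equitable partition into $k-1$ induced forests.
   Context: A proper coloring of a graph $G$ is acyclic if every cycle of $G$ contains vertices of at least 3 distinct colors. An equitable partition of $G$ into $m$ parts is a partition of the vertex set of $G$ into $m$ sets $S_1,\dots,S_m$ (some possibly empty) such that $||S_i|-|S_j||\le 1$ for all $i,j$. An equitable partition into $m$ induced forests is an equitable partition into $m$ parts in which each part induces a forest (acyclic graph; the empty graph counts as a forest). *)

theory Defs
  imports "Graph_Theory.Digraph_Component" "HOL-Library.Disjoint_Sets"
begin

text \<open>
  Finite simple graphs are instances of the locale \<^locale>\<open>graph\<close>: finite symmetric digraphs
  without loops and parallel arcs, an undirected edge being a pair of opposite arcs.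
  \<^const>\<open>pre_digraph.cycle\<close> also accepts the closed walk of length 2 that traverses an edge back
  and forth; the cycles of the undirected graph are those of length at least 3. For the same
  reason \<^const>\<open>forest\<close> cannot be used for undirected graphs.
\<close>

definition undirected_cycle :: "('a, 'b) pre_digraph \<Rightarrow> 'b awalk \<Rightarrow> bool" where
  "undirected_cycle G p \<longleftrightarrow> pre_digraph.cycle G p \<and> 3 \<le> length p"

definition undirected_forest :: "('a, 'b) pre_digraph \<Rightarrow> bool" where
  "undirected_forest G \<longleftrightarrow> \<not> (\<exists>p. undirected_cycle G p)"

definition proper_coloring :: "('a, 'b) pre_digraph \<Rightarrow> ('a \<Rightarrow> 'c) \<Rightarrow> bool" where
  "proper_coloring G c \<longleftrightarrow> (\<forall>e \<in> arcs G. c (tail G e) \<noteq> c (head G e))"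

text \<open>As a cycle is a closed walk, its vertices are the tails of its arcs.\<close>

definition acyclic_coloring :: "('a, 'b) pre_digraph \<Rightarrow> ('a \<Rightarrow> 'c) \<Rightarrow> bool" where
  "acyclic_coloring G c \<longleftrightarrow> proper_coloring G c \<and>
     (\<forall>p. undirected_cycle G p \<longrightarrow> 3 \<le> card (c ` tail G ` set p))"

text \<open>The parts \<open>S i\<close>, \<open>i < m\<close>, may be empty.\<close>

definition equitable_partition :: "'a set \<Rightarrow> nat \<Rightarrow> (nat \<Rightarrow> 'a set) \<Rightarrow> bool" where
  "equitable_partition V m S \<longleftrightarrow>
     (\<Union>i<m. S i) = V \<and> disjoint_family_on S {..<m} \<and>
     (\<forall>i<m. \<forall>j<m. \<bar>int (card (S i)) - int (card (S j))\<bar> \<le> 1)"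

definition equitable_forest_partition ::
    "('a, 'b) pre_digraph \<Rightarrow> nat \<Rightarrow> (nat \<Rightarrow> 'a set) \<Rightarrow> bool" where
  "equitable_forest_partition G m S \<longleftrightarrow>
     equitable_partition (verts G) m S \<and> (\<forall>i<m. undirected_forest (G \<restriction> S i))"

end

theory Submission
  imports Defs
begin

text \<open>
  Only the color classes matter: since any two of them induce a forest, it suffices to split the
  vertices equitably into \<open>k - 1\<close> parts that meet at most two classes each. Of \<open>m + 1\<close> classes with
  \<open>n\<close> elements in total, a smallest one has at most \<open>n / (m + 1)\<close> elements, and together with a
  largest other one at least \<open>n / m\<close>. So a part of the required size consists of a smallest class
  and some elements of a largest one; \<open>m\<close> classes remain, and induction splits them into \<open>m - 1\<close>
  parts.
\<close>

lemma two_class_partition: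
  fixes c :: "'a \<Rightarrow> 'c" and m q :: nat
  assumes "finite W" "c ` W \<subseteq> K" "card K = m + 1"
    and "q * m \<le> card W" "card W \<le> (q + 1) * m"
  shows "\<exists>S. (\<Union>i<m. S i) = W \<and> disjoint_family_on S {..<m} \<and>
    (\<forall>i<m. card (S i) \<in> {q, q + 1} \<and> card (c ` S i) \<le> 2)"
  using assms
\<comment> \<open>\<open>q\<close> stays fixed: the two bounds say that \<open>card W\<close> is a
  sum of \<open>m\<close> sizes from \<open>{q, q + 1}\<close>, and this survives the removal of one
  part.\<close>
proof (induction m arbitrary: W K)
  case 0
  then show ?case by (auto simp: disjoint_family_on_def)
next
  case (Suc m)
  let ?class = "\<lambda>x. {v \<in> W. c v = x}"
  have finK: "finite K"
    using Suc.prems(3) by (simp add: card_ge_0_finite)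
  have card_W: "card W = (\<Sum>x\<in>K. card (?class x))"
  proof -
    have "(\<Union>x\<in>K. ?class x) = W" using Suc.prems(2) by auto
    moreover have "card (\<Union>x\<in>K. ?class x) = (\<Sum>x\<in>K. card (?class x))"
      using Suc.prems(1) finK by (intro card_UN_disjoint) auto
    ultimately show ?thesis by simp
  qed
  define a where "a = arg_min_on (\<lambda>x. card (?class x)) K"
  have "K \<noteq> {}" using Suc.prems(3) by auto
  then have a: "a \<in> K" using arg_min_if_finite(1)[OF finK] unfolding a_def by simp
  have a_min: "card (?class a) \<le> card (?class x)" if "x \<in> K" for x
    using arg_min_least[OF finK \<open>K \<noteq> {}\<close> that, of "\<lambda>x. card (?class x)"] unfolding a_def .
  have card_Ka: "card (K - {a}) = Suc m" using a finK Suc.prems(3) by simp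
  then have Ka_ne: "K - {a} \<noteq> {}" by force
  have "Max ((\<lambda>x. card (?class x)) ` (K - {a})) \<in> (\<lambda>x. card (?class x)) ` (K - {a})"
    using Ka_ne finK by (intro Max_in) auto
  then obtain b where b: "b \<in> K - {a}"
    and b_Max: "Max ((\<lambda>x. card (?class x)) ` (K - {a})) = card (?class b)" by blast
  have b_max: "card (?class x) \<le> card (?class b)" if "x \<in> K - {a}" for x
    unfolding b_Max[symmetric] using finK that by (intro Max_ge) auto
  \<comment> \<open>The induction step has \<open>m + 2\<close> classes for \<open>m + 1\<close>
    parts, hence the different factors here and in \<open>large\<close>.\<close>
  have small: "(m + 2) * card (?class a) \<le> card W"
    using sum_bounded_below[of K "card (?class a)" "\<lambda>x. card (?class x)"] a_min Suc.prems(3) card_W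
    by simp
  have "(\<Sum>x\<in>K - {a}. card (?class x)) \<le> (m + 1) * card (?class b)"
    using sum_bounded_above[of "K - {a}" "\<lambda>x. card (?class x)" "card (?class b)"] b_max card_Ka
    by simp
  then have large: "card W \<le> (m + 1) * (card (?class a) + card (?class b))"
    unfolding card_W sum.remove[OF finK a] by (simp add: algebra_simps)
  \<comment> \<open>The part gets size \<open>q + 1\<close> only if all parts must have this size.\<close>
  define s where "s = (if card W < (q + 1) * (m + 1) then q else q + 1)"
  \<comment> \<open>The bound is strict with \<open>s + 1\<close> because \<open>card W\<close>
    itself may exceed \<open>(m + 2) * s\<close>.\<close>
  have "(m + 2) * card (?class a) < (m + 2) * (s + 1)"
  proof -
    have "card W < (m + 2) * (s + 1)"
      using Suc.prems(5) by (auto simp: s_def algebra_simps)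
    then show ?thesis using small by linarith
  qed
  then have a_le: "card (?class a) \<le> s" unfolding mult_less_cancel1 by simp
  \<comment> \<open>In both cases \<open>s\<close> is \<open>card W\<close> divided by
    \<open>m + 1\<close>, rounded down.\<close>
  have "(m + 1) * s \<le> (m + 1) * (card (?class a) + card (?class b))"
  proof -
    have "(m + 1) * s \<le> card W"
      using Suc.prems(4) by (auto simp: s_def algebra_simps)
    then show ?thesis using large by linarith
  qed
  then have s_le: "s \<le> card (?class a) + card (?class b)"
    unfolding mult_le_cancel1 by simp
  then have "s - card (?class a) \<le> card (?class b)" by simp
  then obtain B where B: "B \<subseteq> ?class b" "card B = s - card (?class a)" "finite B"
    by (rule obtain_subset_with_card_n)
  let ?P = "?class a \<union> B"
  have "?class a \<inter> B = {}" using B(1) b by blast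
  then have "card ?P = card (?class a) + card B"
    using B(3) Suc.prems(1) by (intro card_Un_disjoint) simp_all
  then have card_P: "card ?P = s" using B(2) a_le by linarith
  have P_sub: "?P \<subseteq> W" using B(1) by blast
  have "card (c ` ?P) \<le> card {a, b}"
    using B(1) by (intro card_mono) auto
  then have colors_P: "card (c ` ?P) \<le> 2"
    using card_insert_le_m1[of 2 "{b}" a] by simp
  have card_rest: "card (W - ?P) = card W - s"
    using card_Diff_subset[OF finite_subset[OF P_sub Suc.prems(1)] P_sub] unfolding card_P .
  obtain S where S: "(\<Union>i<m. S i) = W - ?P" "disjoint_family_on S {..<m}"
    "\<And>i. i < m \<Longrightarrow> card (S i) \<in> {q, q + 1} \<and> card (c ` S i) \<le> 2"
  proof -
    \<comment> \<open>Class \<open>a\<close> is used up entirely, so its color disappears; leftovers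
      of class \<open>b\<close> may keep theirs.\<close>
    have "c ` (W - ?P) \<subseteq> K - {a}" using Suc.prems(2) by auto
    \<comment> \<open>If \<open>s = q\<close>, strictness in the definition of \<open>s\<close>
      gives \<open>card W - q < (q + 1) * m + 1\<close>; otherwise
      \<open>card W = (q + 1) * (m + 1)\<close>.\<close>
    moreover have "q * m \<le> card (W - ?P)" "card (W - ?P) \<le> (q + 1) * m"
      unfolding card_rest using Suc.prems(4,5) by (auto simp: s_def algebra_simps)
    ultimately show thesis
      using Suc.IH[of "W - ?P" "K - {a}"] Suc.prems(1) card_Ka that by auto
  qed
  have "(\<Union>i<Suc m. (S(m := ?P)) i) = (\<Union>i<m. S i) \<union> ?P"
    by (auto simp: lessThan_Suc)
  then have "(\<Union>i<Suc m. (S(m := ?P)) i) = W"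
    using S(1) P_sub by auto
  moreover have "disjoint_family_on (S(m := ?P)) {..<Suc m}"
  proof -
    have "?P \<inter> (\<Union>i<m. S i) = {}" using S(1) by blast
    moreover have "disjoint_family_on (S(m := ?P)) {..<m}"
      using S(2) by (simp add: disjoint_family_on_def)
    ultimately show ?thesis
      by (simp add: lessThan_Suc disjoint_family_on_insert)
  qed
  moreover have "card ((S(m := ?P)) i) \<in> {q, q + 1} \<and> card (c ` (S(m := ?P)) i) \<le> 2"
    if "i < Suc m" for i
    using that S(3) card_P colors_P by (auto simp: s_def less_Suc_eq)
  ultimately show ?case by blast
qed

text \<open>Acyclicity of a coloring concerns cycles of \<open>G\<close>, so cycles of a part must
  be transferred to \<open>G\<close> without losing track of their vertices.\<close>

lemma (in wf_digraph) cycle_induce_subgraph: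
  assumes "U \<subseteq> verts G" "pre_digraph.cycle (G \<restriction> U) p"
  shows "cycle p" "tail G ` set p \<subseteq> U"
proof -
  have "subgraph (G \<restriction> U) G"
    using induced_induce[OF assms(1)] by (rule induced_imp_subgraph)
  then show "cycle p" using subgraph_cycle assms(2) by blast
  obtain u where "pre_digraph.awalk (G \<restriction> U) u p u"
    using assms(2) unfolding pre_digraph.cycle_def by blast
  then have "set p \<subseteq> arcs (G \<restriction> U)"
    unfolding pre_digraph.awalk_def by blast
  then show "tail G ` set p \<subseteq> U" by auto
qed

text \<open>A cycle inside \<open>U\<close> would be a cycle of \<open>G\<close> and show three
  colors on \<open>U\<close>.\<close>

lemma undirected_forest_two_colors:
  assumes "fin_digraph G" "acyclic_coloring G c" "U \<subseteq> verts G" "card (c ` U) \<le> 2"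
  shows "undirected_forest (G \<restriction> U)"
  unfolding undirected_forest_def
proof
  interpret fin_digraph G by fact
  assume "\<exists>p. undirected_cycle (G \<restriction> U) p"
  then obtain p where p: "pre_digraph.cycle (G \<restriction> U) p" "3 \<le> length p"
    unfolding undirected_cycle_def by blast
  note cyc = cycle_induce_subgraph[OF assms(3) p(1)]
  have "3 \<le> card (c ` tail G ` set p)"
    using assms(2) cyc(1) p(2) unfolding acyclic_coloring_def undirected_cycle_def by blast
  also have "\<dots> \<le> card (c ` U)"
    using cyc(2) finite_subset[OF assms(3) finite_verts] by (intro card_mono image_mono) auto
  finally show False using assms(4) by simp
qed

theorem theorem4:
  fixes G :: "('a, 'b) pre_digraph" and c :: "'a \<Rightarrow> 'c" and k :: nat
  assumes "k \<ge> 2"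
    and "graph G"
    and "acyclic_coloring G c"
    and "card (c ` verts G) \<le> k"
  shows "\<exists>S. equitable_forest_partition G (k - 1) S"
proof -
  interpret graph G by fact
  define m where "m = k - 1"
  have m: "m > 0" "k = m + 1" using assms(1) by (auto simp: m_def)
  \<comment> \<open>Colors are renamed to numbers, as \<open>'c\<close> may have fewer than \<open>k\<close> elements.\<close>
  obtain f :: "'c \<Rightarrow> nat" where f: "inj_on f (c ` verts G)" "f ` c ` verts G = {0..<card (c ` verts G)}"
    using ex_bij_betw_finite_nat[of "c ` verts G"] by (auto simp: bij_betw_def)
  define q where "q = card (verts G) div m"
  have "q * m \<le> card (verts G)" by (simp add: q_def)
  moreover have "card (verts G) \<le> (q + 1) * m"
    using dividend_less_div_times[OF m(1), of "card (verts G)"] by (simp add: q_def)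
  moreover have "(f \<circ> c) ` verts G \<subseteq> {..<k}"
    using f(2) assms(4) unfolding image_comp[symmetric] by auto
  ultimately obtain S where S: "(\<Union>i<m. S i) = verts G" "disjoint_family_on S {..<m}"
    "\<And>i. i < m \<Longrightarrow> card (S i) \<in> {q, q + 1} \<and> card ((f \<circ> c) ` S i) \<le> 2"
    using two_class_partition[of "verts G" "f \<circ> c" "{..<k}" m q] m(2) finite_verts card_lessThan by metis
  have "\<bar>int (card (S i)) - int (card (S j))\<bar> \<le> 1" if "i < m" "j < m" for i j
    using S(3)[OF that(1)] S(3)[OF that(2)] by auto
  moreover have "undirected_forest (G \<restriction> S i)" if "i < m" for i
  proof -
    have sub: "S i \<subseteq> verts G" using S(1) that by auto
    have "card (f ` c ` S i) = card (c ` S i)"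
      using sub by (intro card_image inj_on_subset[OF f(1)]) auto
    then have "card (c ` S i) \<le> 2" using S(3)[OF that] by (simp add: image_comp)
    then show ?thesis
      using undirected_forest_two_colors[OF fin_digraph_axioms assms(3)] sub by blast
  qed
  ultimately have "equitable_forest_partition G m S"
    using S(1,2) unfolding equitable_forest_partition_def equitable_partition_def by blast
  then show ?thesis unfolding m_def by blast
qed

end
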